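(* Let $a\in\mathbb{C}^*$ and $b\in\mathbb{C}$. (i) For $2b\notin\mathbb{N}_0$ the $\mathfrak{sl}_2(\mathbb{C})$-module $F_{(a,1)}(M_b)$ is simple. (ii) For $2b\in\mathbb{N}_0$ the module $F_{(a,1)}(M_b)$ has a unique nonzero proper submodule, which is isomorphic to $F_{(a,1)}(M_{-b-1})$, and the corresponding simple quotient is isomorphic to the simple finite dimensional module $L(2b)$ with highest weight $2b$ and dimension $2b+1$. In other words, there is a nonsplit short exact sequence $$0\longrightarrow F_{(a,1)}(M_{-b-1})\longrightarrow F_{(a,1)}(M_b)\longrightarrow L(2b)\longrightarrow 0.$$
   Context: $\mathbb{N}_0$ is the set of nonnegative integers. $e_{i,j}$ are matrix units, $h:=\frac12(e_{1,1}-e_{2,2})\in\mathfrak{sl}_2(\mathbb{C})$, and $\sigma$ is the algebra automorphism of $\mathbb{C}[h]$ with $\sigma(h)=h-1$. For $b\in\mathbb{C}$, $M_b$ is the vector space $\mathbb{C}[h]$ with the $\mathfrak{sl}_2$-action $h\cdot f=hf$, $e_{1,2}\cdot f=(h+b)\sigma f$, $e_{2,1}\cdot f=-(h-b)\sigma^{-1}f$. For $a\in\mathbb{C}^*$, $F_{(a,1)}$ is the functor sending an $\mathfrak{sl}_2$-module to the same vector space with the new action $x\bullet v=\varphi(x)\cdot v$, where $\varphi$ is the automorphism fixing $h$ with $\varphi(e_{1,2})=a e_{1,2}$, $\varphi(e_{2,1})=a^{-1}e_{2,1}$. The highest weight of a module is the eigenvalue of $2h=e_{1,1}-e_{2,2}$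 on a highest weight vector (a nonzero $h$-eigenvector killed by $e_{1,2}$). *)

theory Defs
  imports "Jordan_Normal_Form.VS_Connect" "HOL-Algebra.AbelCoset" Complex_Main
begin

section \<open>The Lie algebra\<close>

definition sl2 :: "complex mat set" where
  "sl2 = {x \<in> carrier_mat 2 2. x $$ (0,0) + x $$ (1,1) = 0}"

definition bracket :: "complex mat \<Rightarrow> complex mat \<Rightarrow> complex mat" where
  "bracket x y = x * y - y * x"

text \<open>Matrix units carry the customary indices starting at 1, whereas matrix entries are
  accessed with indices starting at 0.\<close>

definition munit :: "nat \<Rightarrow> nat \<Rightarrow> complex mat" where
  "munit i j = mat 2 2 (\<lambda>(k, l). if Suc k = i \<and> Suc l = j then 1 else 0)"

definition h_elt :: "complex mat" where
  "h_elt = (1/2) \<cdot>\<^sub>m (munit 1 1 - munit 2 2)"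

section \<open>Modules over the Lie algebra\<close>

text \<open>The fields \<open>mult\<close> and \<open>one\<close> inherited from the record of modules play no role. The
  action is only meaningful for matrices in \<open>sl2\<close> and vectors in the carrier.\<close>

record 'v sl2_rep = "(complex, 'v) module" +
  act :: "complex mat \<Rightarrow> 'v \<Rightarrow> 'v"

locale sl2_module = vectorspace class_ring V for V :: "'v sl2_rep" (structure) +
  assumes act_closed: "\<lbrakk>x \<in> sl2; v \<in> carrier V\<rbrakk> \<Longrightarrow> act V x v \<in> carrier V"
    and act_add: "\<lbrakk>x \<in> sl2; v \<in> carrier V; w \<in> carrier V\<rbrakk> \<Longrightarrow>
      act V x (v \<oplus> w) = act V x v \<oplus> act V x w"
    and act_smult: "\<lbrakk>x \<in> sl2; v \<in> carrier V\<rbrakk> \<Longrightarrow>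
      act V x (c \<odot>\<^bsub>V\<^esub> v) = c \<odot>\<^bsub>V\<^esub> act V x v"
    and add_act: "\<lbrakk>x \<in> sl2; y \<in> sl2; v \<in> carrier V\<rbrakk> \<Longrightarrow>
      act V (x + y) v = act V x v \<oplus> act V y v"
    and smult_act: "\<lbrakk>x \<in> sl2; v \<in> carrier V\<rbrakk> \<Longrightarrow>
      act V (c \<cdot>\<^sub>m x) v = c \<odot>\<^bsub>V\<^esub> act V x v"
    and bracket_act: "\<lbrakk>x \<in> sl2; y \<in> sl2; v \<in> carrier V\<rbrakk> \<Longrightarrow>
      act V (bracket x y) v = act V x (act V y v) \<ominus> act V y (act V x v)"

definition sl2_submodule :: "'v set \<Rightarrow> 'v sl2_rep \<Rightarrow> bool" where
  "sl2_submodule N V \<longleftrightarrow>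
     VectorSpace.subspace class_ring N V \<and> (\<forall>x\<in>sl2. \<forall>v\<in>N. act V x v \<in> N)"

definition simple_sl2 :: "'v sl2_rep \<Rightarrow> bool" where
  "simple_sl2 V \<longleftrightarrow> sl2_module V \<and> carrier V \<noteq> {\<zero>\<^bsub>V\<^esub>} \<and>
     (\<forall>N. sl2_submodule N V \<longrightarrow> N = {\<zero>\<^bsub>V\<^esub>} \<or> N = carrier V)"

definition nonzero_proper_submodule :: "'v set \<Rightarrow> 'v sl2_rep \<Rightarrow> bool" where
  "nonzero_proper_submodule N V \<longleftrightarrow>
     sl2_submodule N V \<and> N \<noteq> {\<zero>\<^bsub>V\<^esub>} \<and> N \<noteq> carrier V"

definition sub_rep :: "'v sl2_rep \<Rightarrow> 'v set \<Rightarrow> 'v sl2_rep" where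
  "sub_rep V N = V\<lparr>carrier := N\<rparr>"

text \<open>The vectors of the quotient are the additive cosets of \<open>N\<close>. Scalar multiplication and
  action are formed representative by representative, in the style of \<open>rcoset_mult\<close>.\<close>

definition quotient_rep :: "'v sl2_rep \<Rightarrow> 'v set \<Rightarrow> 'v set sl2_rep" where
  "quotient_rep V N =
     \<lparr>carrier = a_rcosets\<^bsub>V\<^esub> N, mult = undefined, one = undefined,
      zero = N, add = set_add V,
      smult = (\<lambda>c X. \<Union>v\<in>X. N +>\<^bsub>V\<^esub> (c \<odot>\<^bsub>V\<^esub> v)),
      act = (\<lambda>x X. \<Union>v\<in>X. N +>\<^bsub>V\<^esub> act V x v)\<rparr>"

definition sl2_hom :: "'v sl2_rep \<Rightarrow> 'w sl2_rep \<Rightarrow> ('v \<Rightarrow> 'w) set" where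
  "sl2_hom V W = {f \<in> LinearCombinations.module_hom class_ring V W.
     \<forall>x\<in>sl2. \<forall>v\<in>carrier V. f (act V x v) = act W x (f v)}"

definition sl2_iso :: "'v sl2_rep \<Rightarrow> 'w sl2_rep \<Rightarrow> bool" where
  "sl2_iso V W \<longleftrightarrow> sl2_module V \<and> sl2_module W \<and>
     (\<exists>f\<in>sl2_hom V W. bij_betw f (carrier V) (carrier W))"

definition short_exact ::
    "'u sl2_rep \<Rightarrow> ('u \<Rightarrow> 'v) \<Rightarrow> 'v sl2_rep \<Rightarrow> ('v \<Rightarrow> 'w) \<Rightarrow> 'w sl2_rep \<Rightarrow> bool" where
  "short_exact U f V g W \<longleftrightarrow> sl2_module U \<and> sl2_module V \<and> sl2_module W \<and>
     f \<in> sl2_hom U V \<and> g \<in> sl2_hom V W \<and>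
     inj_on f (carrier U) \<and> f ` carrier U = {v \<in> carrier V. g v = \<zero>\<^bsub>W\<^esub>} \<and>
     g ` carrier V = carrier W"

definition splits :: "'v sl2_rep \<Rightarrow> ('v \<Rightarrow> 'w) \<Rightarrow> 'w sl2_rep \<Rightarrow> bool" where
  "splits V g W \<longleftrightarrow> (\<exists>s\<in>sl2_hom W V. \<forall>w\<in>carrier W. g (s w) = w)"

definition has_highest_weight :: "'v sl2_rep \<Rightarrow> complex \<Rightarrow> bool" where
  "has_highest_weight V k \<longleftrightarrow> (\<exists>v\<in>carrier V. v \<noteq> \<zero>\<^bsub>V\<^esub> \<and>
     act V (munit 1 2) v = \<zero>\<^bsub>V\<^esub> \<and> act V (2 \<cdot>\<^sub>m h_elt) v = k \<odot>\<^bsub>V\<^esub> v)"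

section \<open>The modules in question\<close>

text \<open>\<open>lin_act x p q r\<close> is the linear extension to \<open>sl2\<close> of the assignment sending
  \<open>h_elt\<close>, \<open>munit 1 2\<close>, \<open>munit 2 1\<close> to \<open>p\<close>, \<open>q\<close>, \<open>r\<close>.\<close>

definition lin_act ::
    "complex mat \<Rightarrow> complex poly \<Rightarrow> complex poly \<Rightarrow> complex poly \<Rightarrow> complex poly" where
  "lin_act x p q r = Polynomial.smult (2 * x $$ (0,0)) p
     + Polynomial.smult (x $$ (0,1)) q + Polynomial.smult (x $$ (1,0)) r"

lemma lin_act_basis:
  "lin_act h_elt p q r = p" "lin_act (munit 1 2) p q r = q" "lin_act (munit 2 1) p q r = r"
  by (auto simp: lin_act_def h_elt_def munit_def)

text \<open>Polynomials in \<open>h\<close> are represented by \<open>complex poly\<close>, with \<open>h\<close> being \<open>[:0, 1:]\<close>.\<close>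

definition sigma :: "complex poly \<Rightarrow> complex poly" where
  "sigma f = pcompose f [:-1, 1:]"

lemma inv_sigma: "inv_into UNIV sigma f = pcompose f [:1, 1:]"
proof -
  have "sigma (pcompose g [:1, 1:]) = g" and "pcompose (sigma g) [:1, 1:] = g" for g
    by (simp_all add: sigma_def pcompose_assoc[symmetric] pcompose_pCons)
  then show ?thesis
    by (metis inv_f_eq injI)
qed

definition M_rep :: "complex \<Rightarrow> complex poly sl2_rep" where
  "M_rep b =
     \<lparr>carrier = UNIV, mult = undefined, one = undefined, zero = 0, add = (+),
      smult = Polynomial.smult,
      act = (\<lambda>x f. lin_act x ([:0, 1:] * f)
                           ([:b, 1:] * sigma f)
                           (- ([:-b, 1:] * inv_into UNIV sigma f)))\<rparr>"

definition phi :: "complex \<Rightarrow> complex mat \<Rightarrow> complex mat" where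
  "phi a x = mat_of_rows_list 2 [[x $$ (0,0), a * x $$ (0,1)],
                                 [inverse a * x $$ (1,0), x $$ (1,1)]]"

lemma phi_basis:
  "phi a h_elt = h_elt"
  "phi a (munit 1 2) = a \<cdot>\<^sub>m munit 1 2"
  "phi a (munit 2 1) = inverse a \<cdot>\<^sub>m munit 2 1"
  by (auto simp: phi_def h_elt_def munit_def mat_of_rows_list_def less_2_cases_iff
      intro!: eq_matI)

text \<open>This is the action on objects of the functor \<open>F\<close> with index \<open>(a, 1)\<close>.\<close>

definition F :: "complex \<Rightarrow> 'v sl2_rep \<Rightarrow> 'v sl2_rep" where
  "F a V = V\<lparr>act := (\<lambda>x v. act V (phi a x) v)\<rparr>"

text \<open>The module with highest weight \<open>n\<close> is realised on the binary forms of degree \<open>n\<close>,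
  dehomogenised to polynomials in one variable \<open>t\<close> of degree at most \<open>n\<close>:
  \<open>h_elt\<close>, \<open>munit 1 2\<close>, \<open>munit 2 1\<close> act as the differential operators
  \<open>n/2 - t d/dt\<close>, \<open>d/dt\<close>, \<open>n t - t\<^sup>2 d/dt\<close>. The monomial \<open>t^k\<close> has \<open>2 h_elt\<close>-weight \<open>n - 2 k\<close>.\<close>

definition L_rep :: "nat \<Rightarrow> complex poly sl2_rep" where
  "L_rep n =
     \<lparr>carrier = {p. degree p \<le> n}, mult = undefined, one = undefined, zero = 0, add = (+),
      smult = Polynomial.smult,
      act = (\<lambda>x p. lin_act x (Polynomial.smult (of_nat n / 2) p - [:0, 1:] * pderiv p)
                           (pderiv p)
                           (Polynomial.smult (of_nat n) ([:0, 1:] * p) - [:0, 0, 1:] * pderiv p))\<rparr>"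

end

theory Submission
  imports Defs
begin

text \<open>A nonzero submodule of \<open>M_b\<close> is an ideal \<open>(g)\<close> of \<open>\<complex>[h]\<close>. Since \<open>g\<close> divides
  \<open>(h + b) \<sigma> g\<close> and \<open>(h - b) \<sigma>\<^sup>-\<^sup>1 g\<close>, which have one degree more, the quotients are linear;
  comparing them shows that either \<open>\<sigma> g = g\<close>, so that \<open>g\<close> is constant, or
  \<open>(h + b) \<sigma> g = (h - b - 1) g\<close>. The latter equation propagates the root \<open>-b\<close> of \<open>g\<close> to
  \<open>1 - b, 2 - b, \<dots>\<close>, forever unless \<open>2b\<close> is a natural number \<open>n\<close>, and up to \<open>b\<close> in that case. Then
  \<open>g\<close> is a multiple of \<open>G = \<Prod>k\<le>n. (h + b - k)\<close>, which satisfies the same equation, and the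
  quotient of \<open>g\<close> by \<open>G\<close> is \<open>\<sigma>\<close>-invariant. Multiplication by \<open>G\<close> embeds \<open>M_(-b-1)\<close>, and
  evaluation at the roots of \<open>G\<close> is the projection to \<open>L(n)\<close>. It does not split because \<open>h\<close>
  has no eigenvector in \<open>\<complex>[h]\<close>.\<close>

section \<open>Homomorphisms and quotients\<close>

text \<open>The bracket axiom is stated without subtraction. The concrete records give
  \<open>add\<close> explicitly, while \<open>\<ominus>\<close> unfolds to an inverse in the
  additive group.\<close>

lemma sl2_moduleI:
  fixes V :: "'v sl2_rep" (structure)
  assumes "vectorspace class_ring V"
    and "\<And>x v. \<lbrakk>x \<in> sl2; v \<in> carrier V\<rbrakk> \<Longrightarrow> act V x v \<in> carrier V"
    and "\<And>x v w. \<lbrakk>x \<in> sl2; v \<in> carrier V; w \<in> carrier V\<rbrakk> \<Longrightarrow>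
      act V x (v \<oplus> w) = act V x v \<oplus> act V x w"
    and "\<And>x c v. \<lbrakk>x \<in> sl2; v \<in> carrier V\<rbrakk> \<Longrightarrow>
      act V x (c \<odot>\<^bsub>V\<^esub> v) = c \<odot>\<^bsub>V\<^esub> act V x v"
    and "\<And>x y v. \<lbrakk>x \<in> sl2; y \<in> sl2; v \<in> carrier V\<rbrakk> \<Longrightarrow>
      act V (x + y) v = act V x v \<oplus> act V y v"
    and "\<And>x c v. \<lbrakk>x \<in> sl2; v \<in> carrier V\<rbrakk> \<Longrightarrow>
      act V (c \<cdot>\<^sub>m x) v = c \<odot>\<^bsub>V\<^esub> act V x v"
    and "\<And>x y v. \<lbrakk>x \<in> sl2; y \<in> sl2; v \<in> carrier V\<rbrakk> \<Longrightarrow>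
      act V (bracket x y) v \<oplus> act V y (act V x v) = act V x (act V y v)"
    and "\<And>x y. \<lbrakk>x \<in> sl2; y \<in> sl2\<rbrakk> \<Longrightarrow> bracket x y \<in> sl2"
  shows "sl2_module V"
proof -
  interpret vectorspace class_ring V by fact
  show ?thesis
  proof (unfold_locales, goal_cases)
    case (6 x y v)
    then have "act V x (act V y v) = act V (bracket x y) v \<oplus> act V y (act V x v)"
      using assms(7) by simp
    with 6 show ?case
      by (simp add: assms(2,8) a_minus_def a_assoc M.r_neg)
  qed (use assms in auto)
qed

text \<open>Trace zero eliminates the lower right entry, which leaves the three entries that
  \<open>lin_act\<close> reads.\<close>

lemma bracket_entries:
  assumes "x \<in> sl2" "y \<in> sl2"
  shows "bracket x y $$ (0,0) = x $$ (0,1) * y $$ (1,0) - y $$ (0,1) * x $$ (1,0)"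
    and "bracket x y $$ (0,1) = 2 * (x $$ (0,0) * y $$ (0,1) - y $$ (0,0) * x $$ (0,1))"
    and "bracket x y $$ (1,0) = 2 * (y $$ (0,0) * x $$ (1,0) - x $$ (0,0) * y $$ (1,0))"
    and "bracket x y \<in> sl2"
proof -
  have x: "x \<in> carrier_mat 2 2" "x $$ (Suc 0, Suc 0) = - x $$ (0,0)"
    and y: "y \<in> carrier_mat 2 2" "y $$ (Suc 0, Suc 0) = - y $$ (0,0)"
    using assms by (simp_all add: sl2_def add_eq_0_iff)
  have ij: "bracket x y $$ (i, j)
      = (x $$ (i,0) * y $$ (0,j) + x $$ (i,1) * y $$ (1,j))
      - (y $$ (i,0) * x $$ (0,j) + y $$ (i,1) * x $$ (1,j))" if "i < 2" "j < 2" for i j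
    using x(1) y(1) that by (simp add: bracket_def scalar_prod_def numeral_2_eq_2)
  have carrier: "bracket x y \<in> carrier_mat 2 2"
    using x(1) y(1) unfolding bracket_def by (metis minus_carrier_mat mult_carrier_mat)
  show "bracket x y $$ (0,0) = x $$ (0,1) * y $$ (1,0) - y $$ (0,1) * x $$ (1,0)"
    "bracket x y $$ (0,1) = 2 * (x $$ (0,0) * y $$ (0,1) - y $$ (0,0) * x $$ (0,1))"
    "bracket x y $$ (1,0) = 2 * (y $$ (0,0) * x $$ (1,0) - x $$ (0,0) * y $$ (1,0))"
    by (simp_all add: ij x y algebra_simps)
  show "bracket x y \<in> sl2"
    using carrier by (simp add: sl2_def ij algebra_simps)
qed

lemma sl2_closed:
  assumes "x \<in> sl2" "y \<in> sl2"
  shows "x + y \<in> sl2" "c \<cdot>\<^sub>m x \<in> sl2"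
  using assms unfolding sl2_def
   apply (auto simp: algebra_simps)
  by (metis distrib_left mult_zero_right)

lemma munit_in_sl2: "h_elt \<in> sl2" "munit 1 2 \<in> sl2" "munit 2 1 \<in> sl2"
  by (auto simp: sl2_def h_elt_def munit_def)

context sl2_module
begin

lemma bracket_add:
  assumes "x \<in> sl2" "y \<in> sl2" "v \<in> carrier V"
  shows "act V (bracket x y) v \<oplus> act V y (act V x v) = act V x (act V y v)"
  using assms by (simp add: bracket_act act_closed a_minus_def a_assoc M.l_neg)

lemma sl2_submodule_iff:
  "sl2_submodule N V \<longleftrightarrow> N \<subseteq> carrier V \<and> \<zero> \<in> N \<and> (\<forall>v\<in>N. \<forall>w\<in>N. v \<oplus> w \<in> N) \<and>
     (\<forall>c. \<forall>v\<in>N. c \<odot>\<^bsub>V\<^esub> v \<in> N) \<and> (\<forall>x\<in>sl2. \<forall>v\<in>N. act V x v \<in> N)"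
  unfolding sl2_submodule_def VectorSpace.subspace_def LinearCombinations.submodule_def
  by (auto intro: vectorspace_axioms module_axioms)

text \<open>Every vector of \<open>Q\<close> has the form \<open>p v\<close>, so each axiom is
  carried over from \<open>V\<close> by the listed equations. Quotients become modules this way,
  without separate work on cosets.\<close>

lemma homomorphic_image:
  fixes Q :: "'w sl2_rep"
  assumes carrier: "carrier Q = p ` carrier V"
    and zero: "\<zero>\<^bsub>Q\<^esub> = p \<zero>"
    and add: "\<And>v w. \<lbrakk>v \<in> carrier V; w \<in> carrier V\<rbrakk> \<Longrightarrow> p v \<oplus>\<^bsub>Q\<^esub> p w = p (v \<oplus> w)"
    and smult: "\<And>c v. v \<in> carrier V \<Longrightarrow> c \<odot>\<^bsub>Q\<^esub> p v = p (c \<odot>\<^bsub>V\<^esub> v)"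
    and act: "\<And>x v. \<lbrakk>x \<in> sl2; v \<in> carrier V\<rbrakk> \<Longrightarrow> act Q x (p v) = p (act V x v)"
  shows "sl2_module Q"
proof (rule sl2_moduleI)
  have neg: "\<exists>w\<in>carrier V. p (v \<oplus> w) = p \<zero>" if "v \<in> carrier V" for v
    using that by (intro bexI[of _ "\<ominus> v"]) (auto simp: M.r_neg)
  show "vectorspace class_ring Q"
    by (rule vs_criteria)
      (use neg smult_l_distr smult_r_distr smult_assoc1 smult_one in
        \<open>auto simp: carrier zero add smult class_field a_assoc a_comm a_lcomm\<close>)
qed (auto simp: carrier zero add smult act act_closed act_add act_smult add_act smult_act
    sl2_closed bracket_entries bracket_add)

end

lemma sl2_homD:
  assumes "f \<in> sl2_hom V W"
  shows "v \<in> carrier V \<Longrightarrow> f v \<in> carrier W"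
    and "\<lbrakk>v \<in> carrier V; w \<in> carrier V\<rbrakk> \<Longrightarrow> f (v \<oplus>\<^bsub>V\<^esub> w) = f v \<oplus>\<^bsub>W\<^esub> f w"
    and "v \<in> carrier V \<Longrightarrow> f (c \<odot>\<^bsub>V\<^esub> v) = c \<odot>\<^bsub>W\<^esub> f v"
    and "\<lbrakk>x \<in> sl2; v \<in> carrier V\<rbrakk> \<Longrightarrow> f (act V x v) = act W x (f v)"
  using assms by (auto simp: sl2_hom_def LinearCombinations.module_hom_def)

lemma sl2_hom_zero:
  assumes "sl2_module V" "sl2_module W" "f \<in> sl2_hom V W"
  shows "f \<zero>\<^bsub>V\<^esub> = \<zero>\<^bsub>W\<^esub>"
proof -
  interpret V: sl2_module V by fact
  interpret W: sl2_module W by fact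
  have "mod_hom class_ring V W f"
    using assms(3) by unfold_locales (simp add: sl2_hom_def)
  then show ?thesis by (rule mod_hom.f0_is_0)
qed

lemma sl2_hom_image:
  assumes "sl2_module V" "sl2_module W" "f \<in> sl2_hom V W" "sl2_submodule N V"
  shows "sl2_submodule (f ` N) W"
proof -
  interpret V: sl2_module V by fact
  interpret W: sl2_module W by fact
  note f = sl2_homD[OF assms(3)]
  from assms(4) have N: "N \<subseteq> carrier V" "\<zero>\<^bsub>V\<^esub> \<in> N" "\<And>v w. v \<in> N \<Longrightarrow> w \<in> N \<Longrightarrow> v \<oplus>\<^bsub>V\<^esub> w \<in> N"
    "\<And>c v. v \<in> N \<Longrightarrow> c \<odot>\<^bsub>V\<^esub> v \<in> N" "\<And>x v. x \<in> sl2 \<Longrightarrow> v \<in> N \<Longrightarrow> act V x v \<in> N"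
    by (auto simp: V.sl2_submodule_iff)
  show ?thesis
    unfolding W.sl2_submodule_iff
  proof (intro conjI ballI allI)
    show "\<zero>\<^bsub>W\<^esub> \<in> f ` N"
      using N(2) sl2_hom_zero[OF assms(1-3)] by (metis imageI)
  next
    fix v w assume "v \<in> f ` N" "w \<in> f ` N"
    then show "v \<oplus>\<^bsub>W\<^esub> w \<in> f ` N"
      using N(1,3) f(2) by (auto simp: image_iff subset_iff) metis
  next
    fix c v assume "v \<in> f ` N"
    then show "c \<odot>\<^bsub>W\<^esub> v \<in> f ` N"
      using N(1,4) f(3) by (auto simp: image_iff subset_iff) metis
  next
    fix x v assume "x \<in> sl2" "v \<in> f ` N"
    then show "act W x v \<in> f ` N"
      using N(1,5) f(4) by (auto simp: image_iff subset_iff) metis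
  qed (use N(1) f(1) in auto)
qed

lemma sl2_iso_simple:
  assumes "sl2_iso V W" "simple_sl2 W"
  shows "simple_sl2 V"
proof -
  from assms(1) obtain f where V: "sl2_module V" and W: "sl2_module W"
    and f: "f \<in> sl2_hom V W" "bij_betw f (carrier V) (carrier W)"
    by (auto simp: sl2_iso_def)
  interpret V: sl2_module V by fact
  interpret W: sl2_module W by fact
  note zero = sl2_hom_zero[OF V W f(1)]
  have "N = {\<zero>\<^bsub>V\<^esub>} \<or> N = carrier V" if N: "sl2_submodule N V" for N
  proof -
    have sub: "N \<subseteq> carrier V" using N by (simp add: V.sl2_submodule_iff)
    have "f ` N = {\<zero>\<^bsub>W\<^esub>} \<or> f ` N = carrier W"
      using assms(2) sl2_hom_image[OF V W f(1) N] by (simp add: simple_sl2_def)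
    then have "f ` N = f ` {\<zero>\<^bsub>V\<^esub>} \<or> f ` N = f ` carrier V"
      using f(2) zero by (auto simp: bij_betw_def)
    then show ?thesis
      using f(2) sub inj_on_image_eq_iff[of f "carrier V"]
      by (metis V.M.zero_closed bij_betw_def empty_subsetI insert_subset order_refl)
  qed
  moreover have "carrier V \<noteq> {\<zero>\<^bsub>V\<^esub>}"
    using assms(2) f(2) zero by (auto simp: simple_sl2_def bij_betw_def)
  ultimately show ?thesis using V by (simp add: simple_sl2_def)
qed

text \<open>The cosets of the kernel are the fibres of \<open>g\<close>. The quotient is therefore
  the image of \<open>V\<close> under the map that sends a vector to its fibre, and \<open>g\<close>
  descends to the fibres bijectively.\<close>

lemma first_isomorphism:
  assumes V: "sl2_module V" and W: "sl2_module W" and g: "g \<in> sl2_hom V W"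
    and surj: "g ` carrier V = carrier W"
  shows "sl2_iso (quotient_rep V {v \<in> carrier V. g v = \<zero>\<^bsub>W\<^esub>}) W"
proof -
  interpret V: sl2_module V by fact
  interpret W: sl2_module W by fact
  interpret mod_hom class_ring V W g
    using g by unfold_locales (simp add: sl2_hom_def)
  note g = sl2_homD[OF g]
  define N where "N = {v \<in> carrier V. g v = \<zero>\<^bsub>W\<^esub>}"
  define p where "p v = {w \<in> carrier V. g w = g v}" for v
  define Q where "Q = quotient_rep V N"
  have coset: "N +>\<^bsub>V\<^esub> v = p v" if v: "v \<in> carrier V" for v
  proof (intro equalityI subsetI)
    fix w assume w: "w \<in> p v"
    then have wV: "w \<in> carrier V" and gw: "g w = g v"
      by (simp_all add: p_def)
    have "g (w \<ominus>\<^bsub>V\<^esub> v) = \<zero>\<^bsub>W\<^esub>"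
      using v wV by (simp add: gw a_minus_def W.r_neg)
    then have "w \<ominus>\<^bsub>V\<^esub> v \<in> N"
      using v wV by (simp add: N_def)
    moreover have "w = (w \<ominus>\<^bsub>V\<^esub> v) \<oplus>\<^bsub>V\<^esub> v"
      using v wV by (simp add: V.a_assoc V.l_neg a_minus_def)
    ultimately show "w \<in> N +>\<^bsub>V\<^esub> v"
      unfolding a_r_coset_def' by blast
  next
    fix w assume "w \<in> N +>\<^bsub>V\<^esub> v"
    then obtain n where "n \<in> N" "w = n \<oplus>\<^bsub>V\<^esub> v"
      unfolding a_r_coset_def' by blast
    then show "w \<in> p v"
      using v by (simp add: p_def N_def g)
  qed
  have p_eq: "p u = p v" if "u \<in> p v" for u v
    using that by (auto simp: p_def)
  have p_self: "v \<in> p v" if "v \<in> carrier V" for v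
    using that by (simp add: p_def)
  \<comment> \<open>If \<open>F\<close> respects fibres, all representatives yield one and the same
    coset, so the unions in \<open>quotient_rep\<close> collapse.\<close>
  have union: "(\<Union>u\<in>p v. N +>\<^bsub>V\<^esub> F u) = p (F v)"
    if "v \<in> carrier V" "\<And>u. u \<in> p v \<Longrightarrow> F u \<in> p (F v)" for F v
  proof -
    have "N +>\<^bsub>V\<^esub> F u = p (F v)" if "u \<in> p v" for u
      using \<open>\<And>u. _ \<Longrightarrow> F u \<in> p (F v)\<close>[OF that] coset[of "F u"] p_eq[of "F u" "F v"]
      by (simp add: p_def)
    then show ?thesis
      using p_self[OF that(1)] by blast
  qed
  have carrier: "carrier Q = p ` carrier V"
    using coset by (auto simp: Q_def quotient_rep_def A_RCOSETS_def')
  have Q_zero: "\<zero>\<^bsub>Q\<^esub> = p \<zero>\<^bsub>V\<^esub>"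
    by (simp add: Q_def quotient_rep_def p_def N_def)
  have Q_add: "p v \<oplus>\<^bsub>Q\<^esub> p w = p (v \<oplus>\<^bsub>V\<^esub> w)" if v: "v \<in> carrier V" and w: "w \<in> carrier V" for v w
  proof -
    have "\<exists>s\<in>p v. \<exists>t\<in>p w. u = s \<oplus>\<^bsub>V\<^esub> t" if u: "u \<in> p (v \<oplus>\<^bsub>V\<^esub> w)" for u
    proof (intro bexI)
      have uV: "u \<in> carrier V" and gu: "g u = g v \<oplus>\<^bsub>W\<^esub> g w"
        using u v w by (simp_all add: p_def g(2))
      show "u = (u \<ominus>\<^bsub>V\<^esub> w) \<oplus>\<^bsub>V\<^esub> w"
        using uV w by (simp add: a_minus_def V.a_assoc V.l_neg)
      have "g (u \<ominus>\<^bsub>V\<^esub> w) = (g v \<oplus>\<^bsub>W\<^esub> g w) \<ominus>\<^bsub>W\<^esub> g w"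
        using uV w by (simp add: gu)
      also have "\<dots> = g v"
        using v w by (simp add: a_minus_def W.a_assoc W.r_neg)
      finally show "u \<ominus>\<^bsub>V\<^esub> w \<in> p v"
        using uV w by (simp add: p_def)
    qed (use w p_self in simp)
    then have "p (v \<oplus>\<^bsub>V\<^esub> w) \<subseteq> (\<Union>s\<in>p v. \<Union>t\<in>p w. {s \<oplus>\<^bsub>V\<^esub> t})"
      by blast
    moreover have "s \<oplus>\<^bsub>V\<^esub> t \<in> p (v \<oplus>\<^bsub>V\<^esub> w)" if "s \<in> p v" "t \<in> p w" for s t
      using that v w by (simp add: p_def g(2))
    ultimately show ?thesis
      by (auto simp: Q_def quotient_rep_def set_add_def')
  qed
  have Q_smult: "c \<odot>\<^bsub>Q\<^esub> p v = p (c \<odot>\<^bsub>V\<^esub> v)" if "v \<in> carrier V" for c v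
    unfolding Q_def quotient_rep_def using union[OF that, of "\<lambda>u. c \<odot>\<^bsub>V\<^esub> u"] that
    by (auto simp: p_def g)
  have Q_act: "act Q x (p v) = p (act V x v)" if "x \<in> sl2" "v \<in> carrier V" for x v
    unfolding Q_def quotient_rep_def using union[OF that(2), of "act V x"] that
    by (auto simp: p_def g V.act_closed)
  have Q: "sl2_module Q"
    by (rule V.homomorphic_image[of _ p]) (fact carrier Q_zero Q_add Q_smult Q_act)+
  \<comment> \<open>\<open>g\<close> is constant on a coset, so the image of the coset is a
    singleton.\<close>
  define f where "f X = the_elem (g ` X)" for X
  have f: "f (p v) = g v" if "v \<in> carrier V" for v
  proof -
    have "g ` p v = {g v}" using that by (auto simp: p_def)
    then show ?thesis by (simp add: f_def)
  qed
  have "f \<in> sl2_hom Q W"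
    by (auto simp: sl2_hom_def LinearCombinations.module_hom_def carrier Q_add Q_smult Q_act f g V.act_closed)
  moreover have "bij_betw f (carrier Q) (carrier W)"
    unfolding bij_betw_def
  proof
    show "inj_on f (carrier Q)"
      by (auto simp: inj_on_def carrier f) (auto simp: p_def)
    show "f ` carrier Q = carrier W"
      using surj by (auto simp: carrier image_image f)
  qed
  ultimately show ?thesis
    using Q W by (auto simp: sl2_iso_def Q_def N_def)
qed

section \<open>Actions by operators on polynomials\<close>

text \<open>A common form for the twisted \<open>M_rep\<close> and for \<open>L_rep\<close>: a set
  of polynomials on which \<open>h_elt\<close>, \<open>munit 1 2\<close>, \<open>munit 2 1\<close>
  act by three given operators.\<close>

definition poly_rep ::
  "complex poly set \<Rightarrow> (complex poly \<Rightarrow> complex poly) \<Rightarrow> (complex poly \<Rightarrow> complex poly) \<Rightarrow>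
   (complex poly \<Rightarrow> complex poly) \<Rightarrow> complex poly sl2_rep" where
  "poly_rep S H E D =
     \<lparr>carrier = S, mult = undefined, one = undefined, zero = 0, add = (+),
      smult = Polynomial.smult, act = (\<lambda>x f. lin_act x (H f) (E f) (D f))\<rparr>"

lemma poly_rep_simps [simp]:
  "carrier (poly_rep S H E D) = S"
  "\<zero>\<^bsub>poly_rep S H E D\<^esub> = 0"
  "f \<oplus>\<^bsub>poly_rep S H E D\<^esub> g = f + g"
  "c \<odot>\<^bsub>poly_rep S H E D\<^esub> f = Polynomial.smult c f"
  "act (poly_rep S H E D) x f = lin_act x (H f) (E f) (D f)"
  by (simp_all add: poly_rep_def)

definition poly_linear :: "(complex poly \<Rightarrow> complex poly) \<Rightarrow> bool" where
  "poly_linear T \<longleftrightarrow> (\<forall>f g. T (f + g) = T f + T g) \<and>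
     (\<forall>c f. T (Polynomial.smult c f) = Polynomial.smult c (T f))"

text \<open>These are the relations [h, e] = e, [h, f] = -f and [e, f] = 2h. The coefficients
  reflect that h is half of the usual Cartan element.\<close>

locale sl2_operators =
  fixes H E D :: "complex poly \<Rightarrow> complex poly"
  assumes linear: "poly_linear H" "poly_linear E" "poly_linear D"
    and HE: "H (E f) = E (H f) + E f"
    and HD: "H (D f) = D (H f) - D f"
    and ED: "E (D f) = D (E f) + Polynomial.smult 2 (H f)"
begin

lemmas linear_simps = linear[unfolded poly_linear_def]

lemma poly_rep_module:
  assumes zero: "0 \<in> S" and add: "\<And>f g. f \<in> S \<Longrightarrow> g \<in> S \<Longrightarrow> f + g \<in> S"
    and smult: "\<And>c f. f \<in> S \<Longrightarrow> Polynomial.smult c f \<in> S"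
    and HS: "\<And>f. f \<in> S \<Longrightarrow> H f \<in> S" and ES: "\<And>f. f \<in> S \<Longrightarrow> E f \<in> S"
    and DS: "\<And>f. f \<in> S \<Longrightarrow> D f \<in> S"
  shows "sl2_module (poly_rep S H E D)"
proof (rule sl2_moduleI)
  have "\<exists>g\<in>S. f + g = 0" if "f \<in> S" for f
    using smult[OF that, of "-1"] by (intro bexI[of _ "- f"]) auto
  then show "vectorspace class_ring (poly_rep S H E D)"
    by (intro vs_criteria)
      (auto simp: class_field zero add smult smult_add_left smult_add_right algebra_simps)
next
  fix x y f assume xy: "x \<in> sl2" "y \<in> sl2"
  show "act (poly_rep S H E D) (bracket x y) f
      \<oplus>\<^bsub>poly_rep S H E D\<^esub> act (poly_rep S H E D) y (act (poly_rep S H E D) x f) =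
      act (poly_rep S H E D) x (act (poly_rep S H E D) y f)"
    by (simp add: lin_act_def bracket_entries[OF xy, simplified] linear_simps HE HD ED
        smult_add_left smult_add_right smult_diff_left smult_diff_right algebra_simps)
next
  fix x y :: "complex mat" and f assume xy: "x \<in> sl2" "y \<in> sl2"
  then show "act (poly_rep S H E D) (x + y) f =
      act (poly_rep S H E D) x f \<oplus>\<^bsub>poly_rep S H E D\<^esub> act (poly_rep S H E D) y f"
    by (auto simp: lin_act_def sl2_def smult_add_left algebra_simps)
next
  fix x :: "complex mat" and c f assume "x \<in> sl2"
  then show "act (poly_rep S H E D) (c \<cdot>\<^sub>m x) f =
      c \<odot>\<^bsub>poly_rep S H E D\<^esub> act (poly_rep S H E D) x f"
    by (auto simp: lin_act_def sl2_def smult_add_right algebra_simps)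
qed (auto simp: lin_act_def linear_simps zero add smult HS ES DS bracket_entries
    smult_add_right algebra_simps)

end

text \<open>The action of any matrix is a linear combination of the three operators, so for a
  subspace it suffices to test these.\<close>

lemma poly_rep_submodule_iff:
  assumes "sl2_module (poly_rep S H E D)"
  shows "sl2_submodule N (poly_rep S H E D) \<longleftrightarrow> N \<subseteq> S \<and> 0 \<in> N \<and>
    (\<forall>f\<in>N. \<forall>g\<in>N. f + g \<in> N) \<and> (\<forall>c. \<forall>f\<in>N. Polynomial.smult c f \<in> N) \<and>
    (\<forall>f\<in>N. H f \<in> N \<and> E f \<in> N \<and> D f \<in> N)"
proof -
  have "(\<forall>f\<in>N. H f \<in> N \<and> E f \<in> N \<and> D f \<in> N)" 
    if "\<forall>x\<in>sl2. \<forall>v\<in>N. lin_act x (H v) (E v) (D v) \<in> N"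
    using that munit_in_sl2 by (metis lin_act_basis)
  then show ?thesis
    unfolding sl2_module.sl2_submodule_iff[OF assms] poly_rep_simps
    by (auto simp: lin_act_def)
qed

lemma poly_rep_homI:
  assumes "\<And>f. f \<in> S \<Longrightarrow> T f \<in> S'" and T: "poly_linear T"
    and "\<And>f. f \<in> S \<Longrightarrow> T (H f) = H' (T f)"
    and "\<And>f. f \<in> S \<Longrightarrow> T (E f) = E' (T f)"
    and "\<And>f. f \<in> S \<Longrightarrow> T (D f) = D' (T f)"
  shows "T \<in> sl2_hom (poly_rep S H E D) (poly_rep S' H' E' D')"
  using assms by (auto simp: sl2_hom_def LinearCombinations.module_hom_def lin_act_def poly_linear_def)

lemma sub_poly_rep: "sub_rep (poly_rep S H E D) N = poly_rep N H E D"
  by (simp add: sub_rep_def poly_rep_def)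

section \<open>The modules on polynomials in h\<close>

definition H_M :: "complex poly \<Rightarrow> complex poly" where
  "H_M f = [:0, 1:] * f"

text \<open>The twist by \<open>phi a\<close> amounts to a factor \<open>a\<close> here and
  \<open>inverse a\<close> in \<open>D_M\<close>; the compositions are the shift
  \<open>sigma\<close> and its inverse.\<close>

definition E_M :: "complex \<Rightarrow> complex \<Rightarrow> complex poly \<Rightarrow> complex poly" where
  "E_M a b f = Polynomial.smult a ([:b, 1:] * pcompose f [:-1, 1:])"

definition D_M :: "complex \<Rightarrow> complex \<Rightarrow> complex poly \<Rightarrow> complex poly" where
  "D_M a b f = Polynomial.smult (- inverse a) ([:-b, 1:] * pcompose f [:1, 1:])"

abbreviation twisted_M :: "complex \<Rightarrow> complex \<Rightarrow> complex poly sl2_rep" where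
  "twisted_M a b \<equiv> poly_rep UNIV H_M (E_M a b) (D_M a b)"

lemma F_M_rep: "F a (M_rep b) = twisted_M a b"
proof -
  have "phi a x $$ (0,0) = x $$ (0,0)" "phi a x $$ (0,1) = a * x $$ (0,1)"
    "phi a x $$ (1,0) = inverse a * x $$ (1,0)" for x
    by (simp_all add: phi_def mat_of_rows_list_def)
  then have "lin_act (phi a x) p q r =
      lin_act x p (Polynomial.smult a q) (Polynomial.smult (inverse a) r)" for x p q r
    by (simp add: lin_act_def mult.commute)
  then show ?thesis
    by (simp add: F_def M_rep_def poly_rep_def H_M_def E_M_def D_M_def sigma_def inv_sigma
        del: mult_pCons_left)
qed

text \<open>Passing to values turns the shifts into translations of the argument, which reduces
  operator identities to ring arithmetic.\<close>

lemma poly_ext_eq: "(\<And>x. poly p x = poly q x) \<Longrightarrow> p = (q :: complex poly)"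
  by (simp add: poly_eq_poly_eq_iff[symmetric] fun_eq_iff)

lemma operators_M:
  assumes "a \<noteq> 0"
  shows "sl2_operators H_M (E_M a b) (D_M a b)"
proof
  show "poly_linear H_M" "poly_linear (E_M a b)" "poly_linear (D_M a b)"
    by (auto intro!: poly_ext_eq
        simp: poly_linear_def H_M_def E_M_def D_M_def poly_pcompose algebra_simps)
  fix f
  show "H_M (E_M a b f) = E_M a b (H_M f) + E_M a b f"
    and "H_M (D_M a b f) = D_M a b (H_M f) - D_M a b f"
    and "E_M a b (D_M a b f) = D_M a b (E_M a b f) + Polynomial.smult 2 (H_M f)"
    using assms by (auto intro!: poly_ext_eq
        simp: H_M_def E_M_def D_M_def poly_pcompose algebra_simps)
qed

lemma module_M: "a \<noteq> 0 \<Longrightarrow> sl2_module (twisted_M a b)"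
  by (rule sl2_operators.poly_rep_module[OF operators_M]) auto

section \<open>Submodules as ideals and the shift equation of their generators\<close>

lemma shift_invariant_const:
  fixes q :: "complex poly"
  assumes "pcompose q [:-1, 1:] = q"
  shows "degree q = 0"
proof -
  have step: "poly q (x - 1) = poly q x" for x
    using arg_cong[OF assms, of "\<lambda>p. poly p x"] by (simp add: poly_pcompose)
  \<comment> \<open>Invariance carries the value at 0 to every natural number, which gives
    infinitely many roots.\<close>
  have "poly (q - [:poly q 0:]) (of_nat k) = 0" for k :: nat
  proof (induction k)
    case (Suc k)
    then show ?case using step[of "of_nat (Suc k)"] by simp
  qed simp
  then have "range (of_nat :: nat \<Rightarrow> complex) \<subseteq> {x. poly (q - [:poly q 0:]) x = 0}"
    by auto
  moreover have "infinite (range (of_nat :: nat \<Rightarrow> complex))"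
    by (simp add: finite_image_iff inj_of_nat)
  ultimately have "q = [:poly q 0:]"
    using poly_roots_finite[of "q - [:poly q 0:]"] finite_subset right_minus_eq by blast
  then show ?thesis by (metis degree_pCons_0)
qed

text \<open>Stability under h makes \<open>N\<close> an ideal, generated by an element of least
  degree. The other two operators then constrain the generator alone.\<close>

lemma submodule_M_generator:
  assumes a: "a \<noteq> 0" and N: "nonzero_proper_submodule N (twisted_M a b)"
  obtains g where "g \<noteq> 0" "\<not> is_unit g" "N = {f. g dvd f}"
    "[:b, 1:] * pcompose g [:-1, 1:] = [:-b-1, 1:] * g"
proof -
  have sub: "0 \<in> N" "\<And>f g. f \<in> N \<Longrightarrow> g \<in> N \<Longrightarrow> f + g \<in> N"
    "\<And>c f. f \<in> N \<Longrightarrow> Polynomial.smult c f \<in> N"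
    "\<And>f. f \<in> N \<Longrightarrow> H_M f \<in> N" "\<And>f. f \<in> N \<Longrightarrow> E_M a b f \<in> N" "\<And>f. f \<in> N \<Longrightarrow> D_M a b f \<in> N"
    and proper: "N \<noteq> {0}" "N \<noteq> UNIV"
    using N by (auto simp: nonzero_proper_submodule_def poly_rep_submodule_iff[OF module_M[OF a]])
  have mult: "q * f \<in> N" if "f \<in> N" for q f
  proof (induction q)
    case (pCons c q)
    have "pCons c q * f = Polynomial.smult c f + H_M (q * f)"
      by (simp add: H_M_def)
    then show ?case using sub(2-4) pCons that by metis
  qed (simp add: sub)
  obtain f0 where "f0 \<in> N" "f0 \<noteq> 0" using sub(1) proper(1) by blast
  then obtain g where g: "g \<in> N" "g \<noteq> 0" and min: "\<And>f. f \<in> N \<Longrightarrow> f \<noteq> 0 \<Longrightarrow> degree g \<le> degree f"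
    using ex_has_least_nat[of "\<lambda>f. f \<in> N \<and> f \<noteq> 0" f0 degree] by blast
  have gen: "g dvd f" if "f \<in> N" for f
  proof (rule ccontr)
    assume "\<not> g dvd f"
    then have "f mod g \<noteq> 0" by (simp add: dvd_eq_mod_eq_0)
    moreover have "f mod g = f + (- (f div g)) * g"
      by (simp add: minus_div_mult_eq_mod[symmetric])
    then have "f mod g \<in> N" using sub(2) mult[OF g(1)] that by metis
    ultimately show False
      using min[of "f mod g"] degree_mod_less[OF g(2), of f] by auto
  qed
  have N_eq: "N = {f. g dvd f}"
  proof (intro equalityI subsetI)
    fix f assume "f \<in> {f. g dvd f}"
    then show "f \<in> N" using mult[OF g(1)] by (metis dvd_def mem_Collect_eq mult.commute)
  qed (use gen in auto)
  have unit: "\<not> is_unit g"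
  proof
    assume "is_unit g"
    then have "g dvd f" for f by (metis dvd_trans one_dvd)
    then show False using N_eq proper(2) by auto
  qed
  \<comment> \<open>A shift preserves degree and leading coefficient, so the quotient has degree 1
    and is monic.\<close>
  have linear: "\<exists>c. u = [:c, 1:]" if "[:d, 1:] * pcompose g [:e, 1:] = g * u" for d e u
  proof -
    have "u \<noteq> 0" using that g(2) by (auto simp: pcompose_eq_0_iff simp del: mult_pCons_left)
    have pc: "pcompose g [:e, 1:] \<noteq> 0" using g(2) by (simp add: pcompose_eq_0_iff)
    have "degree ([:d, 1:] * pcompose g [:e, 1:]) = Suc (degree g)"
      using pc by (subst degree_mult_eq) (auto simp: degree_pcompose)
    then have "degree u = 1"
      using that \<open>u \<noteq> 0\<close> g(2) by (simp add: degree_mult_eq)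
    moreover have "lead_coeff ([:d, 1:] * pcompose g [:e, 1:]) = lead_coeff g"
      by (subst lead_coeff_mult) (simp add: lead_coeff_comp)
    then have "lead_coeff u = 1"
      using that g(2) by (simp add: lead_coeff_mult del: mult_pCons_left)
    ultimately show ?thesis
      by (intro exI[of _ "coeff u 0"] poly_eqI)
        (auto simp: coeff_pCons coeff_eq_0 split: nat.split)
  qed
  have "g dvd [:b, 1:] * pcompose g [:-1, 1:]"
    using gen[OF sub(5)[OF g(1)]] a unfolding E_M_def by (rule dvd_smult_cancel)
  then obtain c where c: "[:b, 1:] * pcompose g [:-1, 1:] = g * [:c, 1:]"
    using linear by (metis dvdE)
  have "g dvd [:-b, 1:] * pcompose g [:1, 1:]"
    using gen[OF sub(6)[OF g(1)]] unfolding D_M_def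
    by (rule dvd_smult_cancel) (use a in simp)
  then obtain d where d: "[:-b, 1:] * pcompose g [:1, 1:] = g * [:d, 1:]"
    using linear by (metis dvdE)
  \<comment> \<open>The first equation at \<open>x + 1\<close> and the second at \<open>x\<close>
    both contain \<open>poly g (x + 1)\<close>, which is eliminated here.\<close>
  have "(x - b) * (x + b + 1) * poly g x = (x + c + 1) * (x + d) * poly g x" for x
  proof -
    have "(x - b) * (x + b + 1) * poly g x = (x - b) * ((x + 1 + b) * poly g x)"
      by (simp add: ac_simps)
    also have "(x + 1 + b) * poly g x = poly g (x + 1) * (x + 1 + c)"
      using arg_cong[OF c, of "\<lambda>p. poly p (x + 1)"] by (simp add: poly_pcompose algebra_simps)
    also have "(x - b) * \<dots> = ((x - b) * poly g (x + 1)) * (x + c + 1)"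
      by (simp add: ac_simps)
    also have "(x - b) * poly g (x + 1) = poly g x * (x + d)"
      using arg_cong[OF d, of "\<lambda>p. poly p x"] by (simp add: poly_pcompose algebra_simps)
    finally show ?thesis by (simp add: ac_simps)
  qed
  \<comment> \<open>Cancelling \<open>g\<close> as a polynomial makes the identity available at the
    roots of \<open>g\<close> too.\<close>
  then have "([:-b, 1:] * [:b + 1, 1:]) * g = ([:c + 1, 1:] * [:d, 1:]) * g"
    by (intro poly_ext_eq) (simp add: algebra_simps)
  then have "[:-b, 1:] * [:b + 1, 1:] = [:c + 1, 1:] * [:d, 1:]"
    using g(2) mult_right_cancel by blast
  then have eq: "poly ([:-b, 1:] * [:b + 1, 1:]) x = poly ([:c + 1, 1:] * [:d, 1:]) x" for x
    by (rule arg_cong)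
  have "(x - b) * (x + b + 1) = (x + c + 1) * (x + d)" for x
    using eq[of x] unfolding poly_mult by (simp add: algebra_simps)
  note quad = this
  \<comment> \<open>The difference of the values at 1 and 0 compares the linear coefficients and
    yields c + d = 0; the value at 0 then determines c up to two choices.\<close>
  have "(1 - b) * (1 + b + 1) - (0 - b) * (0 + b + 1)
      = (1 + c + 1) * (1 + d) - (0 + c + 1) * (0 + d)"
    by (simp only: quad)
  then have d: "d = - c" by (simp add: algebra_simps add_eq_0_iff)
  have "(c - b) * (c + b + 1) = (c + 1) * c - b * (b + 1)"
    by (simp add: algebra_simps)
  also have "\<dots> = 0"
    using quad[of 0] unfolding d by (simp add: algebra_simps)
  finally have "(c - b) * (c + b + 1) = 0" .
  then have "c - b = 0 \<or> c + b + 1 = 0" by simp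
  then have "c = b \<or> c = - b - 1"
    by (metis add.assoc add_eq_0_iff2 eq_iff_diff_eq_0 minus_add_distrib diff_conv_add_uminus)
  moreover have "c \<noteq> b"
  proof
    assume "c = b"
    then have "[:b, 1:] * pcompose g [:-1, 1:] = [:b, 1:] * g" using c by (simp only: mult.commute)
    then have "pcompose g [:-1, 1:] = g" by (metis mult_cancel_left pCons_eq_0_iff zero_neq_one)
    then show False using shift_invariant_const unit g(2) by (simp add: is_unit_iff_degree)
  qed
  ultimately have "c = - b - 1" by blast
  then show thesis
    using that[OF g(2) unit N_eq] c by (simp only: mult.commute)
qed

text \<open>At the point -b the left side vanishes and the right side is -(2b + 1) times the value
  of \<open>g\<close>. At j + 1 - b the left side vanishes by induction and the right factor is j -
  2b. So the values 0, ..., j of 2b + 1 are exactly the ones that could break the chain.\<close>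

lemma shift_equation_roots:
  fixes g :: "complex poly"
  assumes "[:b, 1:] * pcompose g [:-1, 1:] = [:-b-1, 1:] * g"
  shows "(\<And>i. i \<le> j \<Longrightarrow> 2 * b + 1 \<noteq> of_nat i) \<Longrightarrow> poly g (of_nat j - b) = 0"
proof (induction j)
  case 0
  then show ?case
    using arg_cong[OF assms, of "\<lambda>p. poly p (- b)"] by (simp add: poly_pcompose)
      (metis add.inverse_inverse diff_eq_eq diff_minus_eq_add mult_2 add.commute add_eq_0_iff)
next
  case (Suc j)
  have "poly g (of_nat j - b) = 0" using Suc by simp
  then show ?case
    using arg_cong[OF assms, of "\<lambda>p. poly p (of_nat (Suc j) - b)"] Suc.prems[of "Suc j"]
    by (auto simp: poly_pcompose algebra_simps)
qed

lemma simple_M: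
  assumes a: "a \<noteq> 0" and b: "2 * b \<notin> \<nat>"
  shows "simple_sl2 (twisted_M a b)"
proof -
  have "\<not> nonzero_proper_submodule N (twisted_M a b)" for N
  proof
    assume "nonzero_proper_submodule N (twisted_M a b)"
    then obtain g where g: "g \<noteq> 0" "\<not> is_unit g"
      "[:b, 1:] * pcompose g [:-1, 1:] = [:-b-1, 1:] * g"
      using submodule_M_generator[OF a] by metis
    have "2 * b + 1 \<noteq> of_nat i" for i
    proof
      assume i: "2 * b + 1 = of_nat i"
      show False
      proof (cases i)
        \<comment> \<open>For 2b = -1 the chain of roots need not start, but both linear factors of
          the equation coincide and \<open>g\<close> is shift-invariant.\<close>
        case 0
        then have "- b - 1 = b" using i by (simp add: algebra_simps add_eq_0_iff)
        then have "pcompose g [:-1, 1:] = g"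
          using g(3) by (metis mult_cancel_left pCons_eq_0_iff zero_neq_one)
        then show False using shift_invariant_const g by (simp add: is_unit_iff_degree)
      next
        case (Suc j)
        then show False using i b by auto
      qed
    qed
    then have "poly g (of_nat j - b) = 0" for j
      using shift_equation_roots[OF g(3)] by blast
    then have "range (\<lambda>j. of_nat j - b) \<subseteq> {x. poly g x = 0}" by auto
    moreover have "infinite (range (\<lambda>j. of_nat j - b))"
      by (simp add: finite_image_iff inj_def)
    ultimately show False
      using poly_roots_finite[OF g(1)] finite_subset by blast
  qed
  moreover have "UNIV \<noteq> {0 :: complex poly}"
    using one_neq_zero by blast
  ultimately show ?thesis
    using module_M[OF a] by (auto simp: simple_sl2_def nonzero_proper_submodule_def)
qed

section \<open>The finite dimensional quotient\<close>

definition vanishing :: "nat \<Rightarrow> complex \<Rightarrow> complex poly" where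
  "vanishing n b = (\<Prod>k\<le>n. [:b - of_nat k, 1:])"

lemma vanishing_nonzero: "vanishing n b \<noteq> 0"
  by (simp add: vanishing_def)

lemma vanishing_dvd_iff: "vanishing n b dvd f \<longleftrightarrow> (\<forall>k\<le>n. poly f (of_nat k - b) = 0)"
proof (induction n)
  case 0
  then show ?case using poly_eq_0_iff_dvd[of f "- b"] by (simp add: vanishing_def)
next
  case (Suc n)
  let ?r = "of_nat (Suc n) - b"
  have v: "vanishing (Suc n) b = vanishing n b * [:-?r, 1:]"
    by (simp add: vanishing_def algebra_simps)
  \<comment> \<open>The roots are pairwise distinct, so the next one must be a root of the cofactor
    \<open>q\<close>.\<close>
  have nz: "poly (vanishing n b) ?r \<noteq> 0"
  proof -
    have "of_nat (Suc n) \<noteq> (of_nat k :: complex)" if "k \<le> n" for k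
      using that unfolding of_nat_eq_iff by simp
    then show ?thesis by (simp add: vanishing_def poly_prod)
  qed
  show ?case
  proof
    assume "vanishing (Suc n) b dvd f"
    then have "vanishing n b dvd f" "[:-?r, 1:] dvd f"
      unfolding v by (blast dest: dvd_mult_left dvd_mult_right)+
    then show "\<forall>k\<le>Suc n. poly f (of_nat k - b) = 0"
      using Suc poly_eq_0_iff_dvd[of f ?r] le_Suc_eq by metis
  next
    assume f: "\<forall>k\<le>Suc n. poly f (of_nat k - b) = 0"
    then obtain q where q: "f = vanishing n b * q"
      using Suc by (metis dvdE le_SucI)
    then have "poly q ?r = 0" using f nz by (metis le_refl mult_eq_0_iff poly_mult)
    then have "[:-?r, 1:] dvd q" using poly_eq_0_iff_dvd by blast
    then show "vanishing (Suc n) b dvd f" unfolding v q by (rule mult_dvd_mono[OF dvd_refl])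
  qed
qed

text \<open>Both sides are the product of the n + 2 factors with index up to n + 1, with the first
  factor split off on the left and the last one on the right.\<close>

lemma vanishing_shift:
  "[:b, 1:] * vanishing n (b - 1) = [:b - of_nat n - 1, 1:] * vanishing n b"
proof -
  have "[:b, 1:] * vanishing n (b - 1) = (\<Prod>k\<le>Suc n. [:b - of_nat k, 1:])"
    unfolding vanishing_def by (subst prod.atMost_Suc_shift) (simp add: algebra_simps)
  also have "\<dots> = [:b - of_nat n - 1, 1:] * vanishing n b"
    by (simp add: vanishing_def algebra_simps)
  finally show ?thesis .
qed

lemma pcompose_vanishing: "pcompose (vanishing n b) [:c, 1:] = vanishing n (b + c)"
  by (simp add: vanishing_def pcompose_prod pcompose_pCons algebra_simps)

text \<open>Multiplication by \<open>vanishing n b\<close> intertwines the operators for -b - 1 with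
  those for b. The condition 2b = n turns the factor b - n - 1 of \<open>vanishing_shift\<close>
  into -b - 1; the third identity uses that lemma at b + 1.\<close>

lemma vanishing_mult:
  assumes "2 * b = of_nat n"
  shows "vanishing n b * H_M f = H_M (vanishing n b * f)"
    and "vanishing n b * E_M a (- b - 1) f = E_M a b (vanishing n b * f)"
    and "vanishing n b * D_M a (- b - 1) f = D_M a b (vanishing n b * f)"
proof -
  have b: "b - of_nat n - 1 = - b - 1" "b + 1 - of_nat n - 1 = - b" "- (- b - 1) = b + 1"
    by (simp_all add: assms[symmetric])
  have e: "[:b, 1:] * vanishing n (b + - 1) = [:- b - 1, 1:] * vanishing n b"
    using vanishing_shift[of b n] b by simp
  have d: "[:-b, 1:] * vanishing n (b + 1) = [:b + 1, 1:] * vanishing n b"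
    using vanishing_shift[of "b + 1" n] b by simp
  show "vanishing n b * H_M f = H_M (vanishing n b * f)"
    by (simp only: H_M_def mult.left_commute)
  show "vanishing n b * E_M a (- b - 1) f = E_M a b (vanishing n b * f)"
    unfolding E_M_def pcompose_mult pcompose_vanishing mult.assoc[symmetric] e
    by (simp only: mult_smult_right mult.commute mult.left_commute)
  show "vanishing n b * D_M a (- b - 1) f = D_M a b (vanishing n b * f)"
    unfolding D_M_def pcompose_mult pcompose_vanishing mult.assoc[symmetric] d b(3)
    by (simp only: mult_smult_right mult.commute mult.left_commute)
qed

section \<open>The simple module of highest weight n\<close>

definition H_L :: "nat \<Rightarrow> complex poly \<Rightarrow> complex poly" where
  "H_L n p = Polynomial.smult (of_nat n / 2) p - [:0, 1:] * pderiv p"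

definition D_L :: "nat \<Rightarrow> complex poly \<Rightarrow> complex poly" where
  "D_L n p = Polynomial.smult (of_nat n) ([:0, 1:] * p) - [:0, 0, 1:] * pderiv p"

lemma L_rep_eq: "L_rep n = poly_rep {p. degree p \<le> n} (H_L n) pderiv (D_L n)"
  by (simp add: L_rep_def poly_rep_def H_L_def D_L_def)

lemmas L_rep_simps [simp] = poly_rep_simps[of "{p. degree p \<le> n}" "H_L n" pderiv "D_L n" for n,
  folded L_rep_eq]

lemma coeff_H_L: "coeff (H_L n p) k = (of_nat n / 2 - of_nat k) * coeff p k"
  by (cases k) (simp_all add: H_L_def coeff_pderiv algebra_simps)

text \<open>The factor n - k vanishes at k = n, so the operator cannot lead from \<open>t^n\<close>
  to \<open>t^(n+1)\<close> and the degree bound is preserved.\<close>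

lemma coeff_D_L:
  "coeff (D_L n p) 0 = 0"
  "coeff (D_L n p) (Suc k) = (of_nat n - of_nat k) * coeff p k"
   apply (simp add: D_L_def)
  by (cases k) (simp_all add: D_L_def coeff_pderiv algebra_simps)

lemma operators_L: "sl2_operators (H_L n) pderiv (D_L n)"
proof
  show "poly_linear (H_L n)" "poly_linear pderiv" "poly_linear (D_L n)"
    by (auto intro!: poly_ext_eq
        simp: poly_linear_def H_L_def D_L_def pderiv_add pderiv_smult algebra_simps)
  fix f :: "complex poly"
  show "H_L n (pderiv f) = pderiv (H_L n f) + pderiv f"
    by (rule poly_eqI) (simp add: coeff_H_L coeff_pderiv algebra_simps)
  show "H_L n (D_L n f) = D_L n (H_L n f) - D_L n f"
    by (rule poly_eqI, rename_tac k, case_tac k) (simp_all add: coeff_H_L coeff_D_L field_simps)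
  show "pderiv (D_L n f) = D_L n (pderiv f) + Polynomial.smult 2 (H_L n f)"
    by (rule poly_eqI, rename_tac k, case_tac k)
      (simp_all add: coeff_H_L coeff_D_L coeff_pderiv algebra_simps)
qed

lemma module_L: "sl2_module (L_rep n)"
  unfolding L_rep_eq
proof (rule sl2_operators.poly_rep_module[OF operators_L])
  fix f :: "complex poly" assume "f \<in> {p. degree p \<le> n}"
  then have f: "coeff f k = 0" if "k > n" for k
    using that by (simp add: coeff_eq_0)
  show "H_L n f \<in> {p. degree p \<le> n}"
    by (auto intro!: degree_le simp: coeff_H_L f)
  show "pderiv f \<in> {p. degree p \<le> n}"
    by (auto intro!: degree_le simp: coeff_pderiv f)
  have "coeff (D_L n f) k = 0" if "k > n" for k
    using that f[of "k - 1"] by (cases k; cases "k = Suc n") (auto simp: coeff_D_L)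
  then show "D_L n f \<in> {p. degree p \<le> n}"
    by (auto intro!: degree_le)
qed (auto intro: degree_add_le order_trans[OF degree_smult_le])

text \<open>Differentiation brings any nonzero vector of a submodule down to a nonzero constant, and
  \<open>D_L\<close> raises 1 through all monomials up to degree n, because n - k is nonzero for k <
  n.\<close>

lemma simple_L: "simple_sl2 (L_rep n)"
proof -
  have "N = {p. degree p \<le> n}" if N: "sl2_submodule N (L_rep n)" "N \<noteq> {0}" for N
  proof -
    have sub: "N \<subseteq> {p. degree p \<le> n}" "0 \<in> N" "\<And>f g. f \<in> N \<Longrightarrow> g \<in> N \<Longrightarrow> f + g \<in> N"
      "\<And>c f. f \<in> N \<Longrightarrow> Polynomial.smult c f \<in> N"
      "\<And>f. f \<in> N \<Longrightarrow> pderiv f \<in> N" "\<And>f. f \<in> N \<Longrightarrow> D_L n f \<in> N"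
      using N(1) unfolding L_rep_eq poly_rep_submodule_iff[OF module_L[unfolded L_rep_eq]] by auto
    obtain p where "p \<in> N" "p \<noteq> 0" using N(2) sub(2) by blast
    then have "1 \<in> N"
    proof (induction "degree p" arbitrary: p)
      case 0
      then obtain c where "p = [:c:]" "c \<noteq> 0" by (metis degree_eq_zeroE pCons_0_0)
      then have "Polynomial.smult (inverse c) p = 1" by simp
      then show ?case using sub(4) 0 by metis
    next
      case (Suc d)
      have "degree (pderiv p) = d" using Suc(2) by (simp add: degree_pderiv)
      moreover have "pderiv p \<noteq> 0" using Suc(2) by (simp add: pderiv_eq_0_iff)
      ultimately show ?case using Suc sub(5) by metis
    qed
    then have monom: "k \<le> n \<Longrightarrow> monom 1 k \<in> N" for k
    proof (induction k)
      case (Suc k)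
      have "D_L n (monom 1 k) = Polynomial.smult (of_nat n - of_nat k) (monom 1 (Suc k))"
        by (rule poly_eqI, rename_tac j, case_tac j) (simp_all add: coeff_D_L)
      moreover have "of_nat n - of_nat k \<noteq> (0 :: complex)" using Suc by auto
      ultimately have "monom 1 (Suc k)
          = Polynomial.smult (inverse (of_nat n - of_nat k)) (D_L n (monom 1 k))" by simp
      then show ?case using Suc sub(4,6) by simp
    qed simp
    have sum: "(\<Sum>k\<in>K. F k) \<in> N" if "\<And>k. k \<in> K \<Longrightarrow> F k \<in> N" for F and K :: "nat set"
      using that by (induction K rule: infinite_finite_induct) (auto intro: sub(2,3))
    have "p \<in> N" if "degree p \<le> n" for p
    proof -
      have "p = (\<Sum>k\<le>n. Polynomial.smult (coeff p k) (monom 1 k))"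
        using poly_as_sum_of_monoms'[OF that] by (simp add: smult_monom)
      then show ?thesis using sum[of "{..n}"] sub(4) monom by (metis (no_types, lifting) atMost_iff)
    qed
    then show ?thesis using sub(1) by auto
  qed
  moreover have "{p :: complex poly. degree p \<le> n} \<noteq> {0}"
  proof -
    have "(1 :: complex poly) \<in> {p. degree p \<le> n}" by simp
    then show ?thesis using one_neq_zero by blast
  qed
  ultimately show ?thesis
    using module_L[of n] by (auto simp: simple_sl2_def)
qed

lemma dimension_L:
  "vectorspace.fin_dim class_ring (L_rep n)" "vectorspace.dim class_ring (L_rep n) = n + 1"
proof -
  interpret sl2_module "L_rep n" by (rule module_L)
  define A where "A = monom (1 :: complex) ` {..n}"
  have inj: "inj_on (monom (1 :: complex)) {..n}"
    by (auto simp: inj_on_def monom_eq_iff')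
  have A: "finite A" "A \<subseteq> carrier (L_rep n)" "card A = n + 1"
    using card_image[OF inj] by (auto simp: A_def L_rep_eq degree_monom_eq)
  \<comment> \<open>The abstract sum in the module is identified with the ordinary one, so that
    coefficients can be read off.\<close>
  have finsum: "finsum (L_rep n) F B = sum F B" if "finite B" "F \<in> B \<rightarrow> carrier (L_rep n)" for F B
    using that by (induction B rule: finite_induct) (auto simp: Pi_iff)
  have "lincomb c A = (\<Sum>v\<in>A. Polynomial.smult (c v) v)" for c
    unfolding lincomb_def using A by (subst finsum) (auto simp: Pi_iff order_trans[OF degree_smult_le])
  then have coeff: "coeff (lincomb c A) k = (if k \<le> n then c (monom 1 k) else 0)" for c k
    by (simp add: coeff_sum sum.reindex[OF inj] A_def if_distrib cong: if_cong)
  have basis: "basis A"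
    unfolding basis_criterion[OF A(1,2)]
  proof (intro allI impI ex1I conjI)
    fix v assume v: "v \<in> carrier (L_rep n)"
    \<comment> \<open>Coefficient families are indexed by the basis vectors, whose degree recovers
      the exponent; \<open>restrict\<close> makes the family unique.\<close>
    let ?c = "restrict (\<lambda>m. coeff v (degree m)) A"
    show "?c \<in> A \<rightarrow>\<^sub>E carrier class_ring" by simp
    show "lincomb ?c A = v"
      using v by (intro poly_eqI, unfold coeff) (auto simp: A_def degree_monom_eq coeff_eq_0)
    fix c assume c: "c \<in> A \<rightarrow>\<^sub>E carrier class_ring \<and> lincomb c A = v"
    then show "c = ?c"
      using coeff[of c] by (intro PiE_ext[of c A "\<lambda>_. UNIV"]) (auto simp: A_def degree_monom_eq)
  qed
  then show "fin_dim"
    using A(1) unfolding fin_dim_def basis_def by blast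
  show "dim = n + 1"
    using dim_basis[OF A(1) basis] A(3) by simp
qed

lemma highest_weight_L: "has_highest_weight (L_rep n) (of_nat n)"
  unfolding has_highest_weight_def
proof (intro bexI conjI)
  \<comment> \<open>The highest weight vector is the constant polynomial 1.\<close>
  show "act (L_rep n) (munit 1 2) 1 = \<zero>\<^bsub>L_rep n\<^esub>"
    by (simp add: lin_act_basis del: One_nat_def)
  show "act (L_rep n) (2 \<cdot>\<^sub>m h_elt) 1 = of_nat n \<odot>\<^bsub>L_rep n\<^esub> 1"
    by (simp add: lin_act_def h_elt_def munit_def H_L_def)
qed simp_all

section \<open>Evaluation as the projection onto the finite dimensional module\<close>

text \<open>The quotient by the vanishing ideal consists of the functions on the points
  \<open>b, b - 1, \<dots>, -b\<close>. The delta function at \<open>b - k\<close> has the weight of \<open>t^k\<close>, and the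
  factors \<open>a^k * (n choose k)\<close> are forced by compatibility with \<open>munit 1 2\<close>.\<close>

definition evaluation :: "complex \<Rightarrow> complex \<Rightarrow> nat \<Rightarrow> complex poly \<Rightarrow> complex poly" where
  "evaluation a b n f =
     (\<Sum>k\<le>n. monom (a ^ k * of_nat (n choose k) * poly f (b - of_nat k)) k)"

text \<open>Beyond n the binomial coefficient is zero, so one formula serves for every k.\<close>

lemma coeff_evaluation:
  "coeff (evaluation a b n f) k = a ^ k * of_nat (n choose k) * poly f (b - of_nat k)"
  by (simp add: evaluation_def coeff_sum binomial_eq_0)

text \<open>This identity matches the factors of \<open>evaluation\<close> with those of both
  \<open>pderiv\<close> and \<open>D_L\<close>. For k > n both binomial coefficients vanish, so no
  bound on k is required.\<close>

lemma Suc_times_choose_Suc: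
  "of_nat (Suc k) * of_nat (n choose Suc k)
    = (of_nat n - of_nat k) * (of_nat (n choose k) :: 'a :: comm_ring_1)"
proof (cases "k \<le> n")
  case True
  have "Suc k * (n choose Suc k) = (n - k) * (n choose k)"
    by (simp only: binomial_absorption binomial_absorb_comp)
  then show ?thesis using True by (metis of_nat_diff of_nat_mult)
qed (simp add: binomial_eq_0)

text \<open>Coefficients are compared: h has the value b - k at the k-th point, h + b has the value
  n - k, and -(h - b) has the value k, while the shifts move to the neighbouring points.\<close>

lemma evaluation_hom:
  assumes a: "a \<noteq> 0" and b: "2 * b = of_nat n"
  shows "evaluation a b n \<in> sl2_hom (twisted_M a b) (L_rep n)"
  unfolding L_rep_eq
proof (rule poly_rep_homI)
  have n: "of_nat n = 2 * b" using b by simp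
  show "poly_linear (evaluation a b n)"
    by (auto intro!: poly_eqI simp: poly_linear_def coeff_evaluation algebra_simps)
  fix f
  show "evaluation a b n f \<in> {p. degree p \<le> n}"
    by (auto intro!: degree_le simp: coeff_evaluation binomial_eq_0)
  show "evaluation a b n (H_M f) = H_L n (evaluation a b n f)"
    by (rule poly_eqI) (simp add: coeff_evaluation coeff_H_L H_M_def n algebra_simps)
  show "evaluation a b n (E_M a b f) = pderiv (evaluation a b n f)"
  proof (rule poly_eqI)
    fix k
    have "coeff (pderiv (evaluation a b n f)) k =
        a ^ Suc k * (of_nat (Suc k) * of_nat (n choose Suc k)) * poly f (b - of_nat (Suc k))"
      by (simp only: coeff_pderiv coeff_evaluation mult_ac)
    then show "coeff (evaluation a b n (E_M a b f)) k = coeff (pderiv (evaluation a b n f)) k"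
      unfolding Suc_times_choose_Suc
      by (simp add: coeff_evaluation E_M_def poly_pcompose n algebra_simps)
  qed
  show "evaluation a b n (D_M a b f) = D_L n (evaluation a b n f)"
  proof (rule poly_eqI)
    fix k
    show "coeff (evaluation a b n (D_M a b f)) k = coeff (D_L n (evaluation a b n f)) k"
    proof (cases k)
      \<comment> \<open>The factor h - b vanishes at the point b, so the raising operator of the
        target needs no term here.\<close>
      case 0
      then show ?thesis by (simp add: coeff_evaluation coeff_D_L D_M_def)
    next
      case (Suc j)
      have "coeff (evaluation a b n (D_M a b f)) k =
          a ^ j * (of_nat (Suc j) * of_nat (n choose Suc j)) * poly f (b - of_nat j)"
        using a unfolding Suc coeff_evaluation
        by (simp add: D_M_def poly_pcompose field_simps)
      then show ?thesis
        unfolding Suc_times_choose_Suc by (simp add: Suc coeff_evaluation coeff_D_L)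
    qed
  qed
qed

lemma evaluation_eq_0_iff:
  assumes a: "a \<noteq> 0" and b: "2 * b = of_nat n"
  shows "evaluation a b n f = 0 \<longleftrightarrow> vanishing n b dvd f"
proof -
  \<comment> \<open>By 2b = n the evaluation points are the roots of \<open>vanishing n b\<close> in
    reverse order.\<close>
  have pt: "b - of_nat k = of_nat (n - k) - b" if "k \<le> n" for k
    using that b by (simp add: of_nat_diff algebra_simps flip: mult_2)
  have "evaluation a b n f = 0 \<longleftrightarrow> (\<forall>k\<le>n. poly f (b - of_nat k) = 0)"
    using a by (simp add: poly_eq_iff coeff_evaluation) (meson not_le)
  also have "\<dots> \<longleftrightarrow> (\<forall>k\<le>n. poly f (of_nat k - b) = 0)"
    using pt by (metis diff_diff_cancel diff_le_self)
  finally show ?thesis by (simp add: vanishing_dvd_iff)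
qed

text \<open>The image is a nonzero submodule of a simple module, which replaces an interpolation
  argument.\<close>

lemma evaluation_surj:
  assumes a: "a \<noteq> 0" and b: "2 * b = of_nat n"
  shows "range (evaluation a b n) = carrier (L_rep n)"
proof -
  have "sl2_submodule UNIV (twisted_M a b)"
    by (simp add: poly_rep_submodule_iff module_M[OF a])
  then have "sl2_submodule (range (evaluation a b n)) (L_rep n)"
    by (rule sl2_hom_image[OF module_M[OF a] module_L evaluation_hom[OF a b]])
  moreover have "coeff (evaluation a b n 1) 0 = 1"
    by (simp add: coeff_evaluation)
  then have "evaluation a b n 1 \<noteq> 0" by auto
  then have "range (evaluation a b n) \<noteq> {\<zero>\<^bsub>L_rep n\<^esub>}"
    by auto
  ultimately show ?thesis
    using simple_L[of n] by (auto simp: simple_sl2_def)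
qed

section \<open>Existence and uniqueness of the submodule, nonsplitness\<close>

lemma nonzero_proper_submodule_M_iff:
  assumes a: "a \<noteq> 0" and b: "2 * b = of_nat n"
  shows "nonzero_proper_submodule N (twisted_M a b) \<longleftrightarrow> N = {f. vanishing n b dvd f}"
proof
  assume "nonzero_proper_submodule N (twisted_M a b)"
  then obtain g where g: "g \<noteq> 0" "N = {f. g dvd f}"
    "[:b, 1:] * pcompose g [:-1, 1:] = [:-b-1, 1:] * g"
    using submodule_M_generator[OF a] by metis
  let ?v = "vanishing n b"
  \<comment> \<open>Since 2b + 1 = n + 1, the chain of roots is unbroken up to index n.\<close>
  have "2 * b + 1 \<noteq> of_nat i" if "i \<le> n" for i
  proof
    assume "2 * b + 1 = of_nat i"
    then have "of_nat (Suc n) = (of_nat i :: complex)" using b by (simp add: add.commute)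
    then show False using that by (simp only: of_nat_eq_iff)
  qed
  then have "?v dvd g"
    using shift_equation_roots[OF g(3)] by (simp add: vanishing_dvd_iff)
  then obtain q where q: "g = ?v * q" by (elim dvdE)
  have "- b - 1 = b - of_nat n - 1" using b by (simp add: algebra_simps flip: b)
  \<comment> \<open>\<open>g\<close> and \<open>?v\<close> satisfy the same shift equation, so their
    quotient \<open>q\<close> is shift-invariant.\<close>
  then have "([:-b-1, 1:] * ?v) * pcompose q [:-1, 1:] = ([:-b-1, 1:] * ?v) * q"
    using g(3) vanishing_shift[of b n]
    by (simp only: q pcompose_mult pcompose_vanishing mult.assoc[symmetric] add_uminus_conv_diff)
  then have "pcompose q [:-1, 1:] = q"
    using vanishing_nonzero[of n b] by (metis mult_cancel_left mult_eq_0_iff pCons_eq_0_iff zero_neq_one)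
  then have "is_unit q"
    using shift_invariant_const g(1) q by (simp add: is_unit_iff_degree)
  then show "N = {f. ?v dvd f}"
    by (simp add: g(2) q mult_unit_dvd_iff)
next
  assume N: "N = {f. vanishing n b dvd f}"
  have "H_M f \<in> N \<and> E_M a b f \<in> N \<and> D_M a b f \<in> N" if "f \<in> N" for f
  proof -
    have "vanishing n b dvd f" using that N by simp
    then obtain u where "f = vanishing n b * u" by (elim dvdE)
    then show ?thesis by (simp add: N flip: vanishing_mult[OF b])
  qed
  moreover have "0 \<in> N" "\<And>f g. f \<in> N \<Longrightarrow> g \<in> N \<Longrightarrow> f + g \<in> N"
    "\<And>c f. f \<in> N \<Longrightarrow> Polynomial.smult c f \<in> N"
    by (simp_all add: N dvd_smult)
  ultimately have "sl2_submodule N (twisted_M a b)"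
    unfolding poly_rep_submodule_iff[OF module_M[OF a]] by blast
  moreover have "N \<noteq> {0}"
  proof -
    have "vanishing n b \<in> N" using N by simp
    then show ?thesis using vanishing_nonzero by (metis singletonD)
  qed
  moreover have "\<not> vanishing n b dvd 1"
    unfolding vanishing_dvd_iff by (metis le0 poly_1 one_neq_zero)
  then have "N \<noteq> UNIV" using N by blast
  ultimately show "nonzero_proper_submodule N (twisted_M a b)"
    by (simp add: nonzero_proper_submodule_def)
qed

lemma vanishing_hom:
  assumes "2 * b = of_nat n"
  shows "(*) (vanishing n b) \<in> sl2_hom (twisted_M a (- b - 1)) (twisted_M a b)"
  by (rule poly_rep_homI) (simp_all add: vanishing_mult[OF assms] poly_linear_def distrib_left)

text \<open>Division by \<open>vanishing n b\<close> is exact on its multiples and inverts the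
  intertwining multiplication; it is linear on all polynomials, as \<open>poly_rep_homI\<close>
  demands.\<close>

lemma iso_submodule_M:
  assumes a: "a \<noteq> 0" and b: "2 * b = of_nat n"
  shows "sl2_iso (sub_rep (twisted_M a b) {f. vanishing n b dvd f}) (twisted_M a (- b - 1))"
proof -
  let ?v = "vanishing n b"
  let ?N = "{f. ?v dvd f}"
  have "nonzero_proper_submodule ?N (twisted_M a b)"
    by (simp add: nonzero_proper_submodule_M_iff[OF a b])
  then have "sl2_submodule ?N (twisted_M a b)"
    by (simp add: nonzero_proper_submodule_def)
  then have "sl2_module (poly_rep ?N H_M (E_M a b) (D_M a b))"
    unfolding poly_rep_submodule_iff[OF module_M[OF a]]
    by (intro sl2_operators.poly_rep_module[OF operators_M[OF a]]) blast+
  moreover have "(\<lambda>f. f div ?v) \<in>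
      sl2_hom (poly_rep ?N H_M (E_M a b) (D_M a b)) (twisted_M a (- b - 1))"
  proof (rule poly_rep_homI)
    fix f assume "f \<in> ?N"
    then obtain u where u: "f = ?v * u" by (auto elim: dvdE)
    have div: "?v * w div ?v = w" for w
      using vanishing_nonzero by simp
    show "H_M f div ?v = H_M (f div ?v)" "E_M a b f div ?v = E_M a (- b - 1) (f div ?v)"
      "D_M a b f div ?v = D_M a (- b - 1) (f div ?v)"
      unfolding u div vanishing_mult[OF b, symmetric] by (rule refl)+
  qed (simp_all add: poly_linear_def poly_div_add_left div_smult_left)
  moreover have "bij_betw (\<lambda>f. f div ?v) ?N UNIV"
    using vanishing_nonzero[of n b] by (intro bij_betwI[of _ _ _ "(*) ?v"]) auto
  ultimately show ?thesis
    using module_M[OF a] by (auto simp: sl2_iso_def sub_poly_rep)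
qed

text \<open>A section would send the weight vector 1 to an element killed by h - n/2. Multiplication
  by this polynomial is injective, so the element is zero, although \<open>g\<close> should map it
  to 1.\<close>

lemma not_splits_M:
  assumes g: "g \<in> sl2_hom (twisted_M a b) (L_rep n)" and a: "a \<noteq> 0"
  shows "\<not> splits (twisted_M a b) g (L_rep n)"
proof
  assume "splits (twisted_M a b) g (L_rep n)"
  then obtain s where s: "s \<in> sl2_hom (L_rep n) (twisted_M a b)"
    and gs: "\<And>w. w \<in> carrier (L_rep n) \<Longrightarrow> g (s w) = w"
    by (auto simp: splits_def)
  have one: "1 \<in> carrier (L_rep n)" by simp
  have "act (L_rep n) h_elt 1 = (of_nat n / 2) \<odot>\<^bsub>L_rep n\<^esub> 1"
    by (simp add: lin_act_basis H_L_def)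
  then have "act (twisted_M a b) h_elt (s 1) = (of_nat n / 2) \<odot>\<^bsub>twisted_M a b\<^esub> s 1"
    using sl2_homD(3,4)[OF s] one munit_in_sl2(1) by metis
  then have "[:- (of_nat n / 2), 1:] * s 1 = 0"
    by (simp add: lin_act_basis H_M_def)
  then have "s 1 = 0" by (metis mult_eq_0_iff pCons_eq_0_iff zero_neq_one)
  then have "g (s 1) = 0"
    using sl2_hom_zero[OF module_M[OF a] module_L g] by simp
  then show False using gs[OF one] by simp
qed

theorem lemma13:
  fixes a b :: complex
  assumes "a \<noteq> 0"
  shows "(2 * b \<notin> \<nat> \<longrightarrow> simple_sl2 (F a (M_rep b))) \<and>
    (\<forall>n::nat. 2 * b = of_nat n \<longrightarrow>
      (\<exists>N. nonzero_proper_submodule N (F a (M_rep b)) \<and>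
         (\<forall>N'. nonzero_proper_submodule N' (F a (M_rep b)) \<longrightarrow> N' = N) \<and>
         sl2_iso (sub_rep (F a (M_rep b)) N) (F a (M_rep (- b - 1))) \<and>
         simple_sl2 (quotient_rep (F a (M_rep b)) N) \<and>
         sl2_iso (quotient_rep (F a (M_rep b)) N) (L_rep n)) \<and>
      simple_sl2 (L_rep n) \<and>
      vectorspace.fin_dim class_ring (L_rep n) \<and>
      vectorspace.dim class_ring (L_rep n) = n + 1 \<and>
      has_highest_weight (L_rep n) (of_nat n) \<and>
      (\<exists>f g. short_exact (F a (M_rep (- b - 1))) f (F a (M_rep b)) g (L_rep n) \<and>
         \<not> splits (F a (M_rep b)) g (L_rep n)))"
  unfolding F_M_rep
proof (intro conjI impI allI)
  assume "2 * b \<notin> \<nat>"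
  then show "simple_sl2 (twisted_M a b)" by (rule simple_M[OF assms])
next
  fix n :: nat assume b: "2 * b = of_nat n"
  let ?N = "{f. vanishing n b dvd f}"
  \<comment> \<open>With the ideal recognised as a kernel, the quotient is isomorphic to
    \<open>L_rep n\<close> and inherits its simplicity.\<close>
  have kernel: "{v \<in> carrier (twisted_M a b). evaluation a b n v = \<zero>\<^bsub>L_rep n\<^esub>} = ?N"
    by (simp add: evaluation_eq_0_iff[OF assms b])
  have iso: "sl2_iso (quotient_rep (twisted_M a b) ?N) (L_rep n)"
    using first_isomorphism[OF module_M[OF assms] module_L evaluation_hom[OF assms b]]
      evaluation_surj[OF assms b] unfolding kernel by simp
  show "\<exists>N. nonzero_proper_submodule N (twisted_M a b) \<and>
         (\<forall>N'. nonzero_proper_submodule N' (twisted_M a b) \<longrightarrow> N' = N) \<and>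
         sl2_iso (sub_rep (twisted_M a b) N) (twisted_M a (- b - 1)) \<and>
         simple_sl2 (quotient_rep (twisted_M a b) N) \<and>
         sl2_iso (quotient_rep (twisted_M a b) N) (L_rep n)"
    using iso iso_submodule_M[OF assms b] sl2_iso_simple[OF iso simple_L]
    by (intro exI[of _ ?N]) (simp add: nonzero_proper_submodule_M_iff[OF assms b])
  have "range ((*) (vanishing n b)) = ?N"
    by (auto elim: dvdE)
  then have "short_exact (twisted_M a (- b - 1)) ((*) (vanishing n b)) (twisted_M a b)
      (evaluation a b n) (L_rep n)"
    using module_M[OF assms] module_L vanishing_hom[OF b] evaluation_hom[OF assms b]
      evaluation_surj[OF assms b] kernel vanishing_nonzero[of n b]
    by (simp add: short_exact_def inj_on_def)
  then show "\<exists>f g. short_exact (twisted_M a (- b - 1)) f (twisted_M a b) g (L_rep n) \<and>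
         \<not> splits (twisted_M a b) g (L_rep n)"
    using not_splits_M[OF evaluation_hom[OF assms b] assms] by blast
qed (rule simple_L dimension_L highest_weight_L)+

end
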